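(* For $n\ge0$ let $(q)_n:=\prod_{k=1}^n(1-q^k)$ (with $(q)_0=1$). For a positive integer $a$ define formal power series \[B_a(q):=\sum_{n=1}^{\infty}\frac{q^{n^2+an}}{(q)_n^2}=:\sum_{N=1}^\infty b_a(N)q^N,\qquad \widehat{B}_a(q):=\sum_{n=1}^{\infty}\frac{q^{n^2+an}}{(q)_n^2(1-q^{an})}=:\sum_{N=1}^\infty \widehat{b}_a(N)q^N.\] Then for every positive integer $a$ and every $n$, \[\widehat{b}_a(n)=\sum_{j=1}^\infty b_{aj}(n).\] Moreover, with $\mu$ the classical M\"obius function, \[B_a(q)=\sum_{n=1}^\infty \mu(n)\widehat{B}_{an}(q),\qquad b_a(n)=\sum_{j=1}^\infty\mu(j)\widehat{b}_{aj}(n).\] *)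

theory Defs
  imports "HOL-Analysis.Analysis" "HOL-Computational_Algebra.Computational_Algebra"
begin

text \<open>Formal power series are taken over the reals, so that the library's division of formal
  power series and its infinite sums of coefficients are available. A family in
  \<^typ>\<open>real fps\<close> is summable iff each coefficient is nonzero in only finitely many
  members, which is the usual formal notion.\<close>

definition qfact :: "nat \<Rightarrow> real fps" where
  "qfact n = (\<Prod>k=1..n. 1 - fps_X ^ k)"

definition B :: "nat \<Rightarrow> real fps" where
  "B a = (\<Sum>\<^sub>\<infinity>n\<in>{1..}. fps_X ^ (n\<^sup>2 + a * n) / (qfact n)\<^sup>2)"

text \<open>Only meaningful for \<^term>\<open>a > 0\<close>: otherwise the denominators vanish.\<close>

definition Bhat :: "nat \<Rightarrow> real fps" where
  "Bhat a = (\<Sum>\<^sub>\<infinity>n\<in>{1..}. fps_X ^ (n\<^sup>2 + a * n) / ((qfact n)\<^sup>2 * (1 - fps_X ^ (a * n))))"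

definition b :: "nat \<Rightarrow> nat \<Rightarrow> real" where
  "b a N = fps_nth (B a) N"

definition bhat :: "nat \<Rightarrow> nat \<Rightarrow> real" where
  "bhat a N = fps_nth (Bhat a) N"

definition moebius_mu :: "nat \<Rightarrow> int" where
  "moebius_mu n = (if squarefree n then (- 1) ^ card (prime_factors n) else 0)"

text \<open>The defining series converge, so \<^const>\<open>infsum\<close> above denotes a genuine sum.\<close>

lemma summable_on_fps_low_coeffs:
  fixes f :: "nat \<Rightarrow> real fps"
  assumes "\<And>n k. n \<in> A \<Longrightarrow> k < n \<Longrightarrow> fps_nth (f n) k = 0"
  shows "f summable_on A"
proof -
  have "finite {n \<in> A. fps_nth (f n) k \<noteq> 0}" for k
    by (rule finite_subset[of _ "{..k}"]) (use assms in \<open>auto simp: not_le[symmetric]\<close>)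
  then have "(f has_sum Abs_fps (\<lambda>k. \<Sum>n | n \<in> A \<and> fps_nth (f n) k \<noteq> 0. fps_nth (f n) k)) A"
    by (intro has_sum_fpsI) auto
  then show ?thesis by (auto simp: summable_on_def)
qed

lemma qfact_nth_0: "fps_nth (qfact n) 0 = 1"
  by (auto simp: qfact_def fps_prod_nth' intro!: prod.neutral)

lemma fps_X_power_divide_nth_low:
  fixes g :: "real fps"
  assumes "fps_nth g 0 \<noteq> 0" "k < m"
  shows "fps_nth (fps_X ^ m / g) k = 0"
  using assms by (simp add: fps_divide_unit fps_X_power_mult_nth)

lemma less_square_add: "k < n \<Longrightarrow> k < n\<^sup>2 + m" for k n m :: nat
  by (metis power2_nat_le_imp_le nat_le_linear not_le order.strict_trans2 
      power2_nat_le_eq_le le_square power2_eq_square trans_le_add1)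

lemma summable_B: "(\<lambda>n. fps_X ^ (n\<^sup>2 + a * n) / (qfact n)\<^sup>2) summable_on {1..}"
  by (rule summable_on_fps_low_coeffs, rule fps_X_power_divide_nth_low)
     (auto simp: qfact_nth_0 fps_nth_power_0 less_square_add)

lemma summable_Bhat:
  assumes "a > 0"
  shows "(\<lambda>n. fps_X ^ (n\<^sup>2 + a * n) / ((qfact n)\<^sup>2 * (1 - fps_X ^ (a * n)))) summable_on {1..}"
  by (rule summable_on_fps_low_coeffs, rule fps_X_power_divide_nth_low)
     (use assms in \<open>auto simp: qfact_nth_0 fps_nth_power_0 less_square_add power_0_left\<close>)

end

theory Submission
  imports Defs
begin

text \<open>Expanding the geometric series \<open>q\<^bsup>an\<^esup> / (1 - q\<^bsup>an\<^esup>) = \<Sum>\<^sub>j q\<^bsup>ajn\<^esup>\<close>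
  in each term of the series for \<^term>\<open>Bhat a\<close> turns it into the sum of the series for
  \<^term>\<open>B (a * j)\<close>, \<open>j \<ge> 1\<close>. As the coefficient of \<open>q\<^sup>N\<close> in
  \<^term>\<open>B (a * j)\<close> vanishes for \<open>j > N\<close>, this relation is inverted by Moebius inversion,
  carried out on finite sums coefficient by coefficient.\<close>

text \<open>Convergence means that each coefficient is a finite sum over its own support. Passing to
  any finite \<open>C\<close> that covers the support gives one convenient index range such as
  \<open>{1..N}\<close>, so that later arguments stay with finite sums.\<close>

lemma has_sum_fps_nth:
  fixes F :: "'a \<Rightarrow> 'b :: ab_group_add fps"
  assumes "(F has_sum S) A" "finite C" "C \<subseteq> A" "\<And>x. x \<in> A - C \<Longrightarrow> fps_nth (F x) n = 0"
  shows "fps_nth S n = (\<Sum>x\<in>C. fps_nth (F x) n)"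
proof -
  have "fps_nth S n = (\<Sum>x | x \<in> A \<and> fps_nth (F x) n \<noteq> 0. fps_nth (F x) n)"
    using has_sum_fpsD(2)[OF assms(1)] .
  also have "\<dots> = (\<Sum>x\<in>C. fps_nth (F x) n)"
    using assms(2-4) by (intro sum.mono_neutral_left) auto
  finally show ?thesis .
qed

section \<open>Moebius function and inversion over multiples\<close>

lemma sum_minus_one_power_card_Pow:
  assumes "finite A"
  shows "(\<Sum>X\<in>Pow A. (- 1) ^ card X :: 'a :: comm_ring_1) = (if A = {} then 1 else 0)"
proof -
  \<comment> \<open>Multiplying out the product, the subset \<open>X\<close> collects the factors
    from which -1 is chosen.\<close>
  have "(\<Sum>X\<in>Pow A. (- 1) ^ card X :: 'a) = (\<Prod>x\<in>A. - 1 + 1)"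
    by (subst prod_add[OF assms]) simp
  then show ?thesis using assms by (simp add: power_0_left)
qed

lemma prime_factors_prod_primes:
  fixes S :: "nat set"
  assumes "finite S" "\<And>p. p \<in> S \<Longrightarrow> prime p"
  shows "prime_factors (\<Prod>S) = S"
proof -
  have "prime_factors (\<Prod>S) = \<Union> ((prime_factors \<circ> (\<lambda>x. x)) ` S)"
    using assms by (intro prime_factors_prod) (auto dest: prime_gt_0_nat)
  also have "\<dots> = S"
    using assms by (auto simp: prime_prime_factors)
  finally show ?thesis .
qed

lemma squarefree_prod_primes:
  fixes S :: "nat set"
  assumes "\<And>p. p \<in> S \<Longrightarrow> prime p"
  shows "squarefree (\<Prod>S)"
  using assms by (intro squarefree_prod_coprime) (auto intro: primes_coprime squarefree_prime)

lemma prod_prime_factors_squarefree: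
  fixes n :: nat
  assumes "squarefree n"
  shows "\<Prod>(prime_factors n) = n"
proof -
  have "n \<noteq> 0" using assms by (metis not_squarefree_0)
  then have "n = (\<Prod>p\<in>prime_factors n. p ^ multiplicity p n)"
    by (simp add: prod_prime_factors)
  also have "\<dots> = \<Prod>(prime_factors n)"
    using assms \<open>n \<noteq> 0\<close> by (intro prod.cong) (auto simp: squarefree_factorial_semiring')
  finally show ?thesis ..
qed

text \<open>Only squarefree divisors count, and they correspond to the subsets of
  \<open>prime_factors m\<close>. The alternating sum over subsets vanishes unless there are no
  prime factors at all, that is, unless m = 1.\<close>

lemma sum_moebius_mu_divisors:
  assumes "m > 0"
  shows "(\<Sum>d | d dvd m. moebius_mu d) = (if m = 1 then 1 else 0)"
proof -
  have "(\<Sum>d | d dvd m. moebius_mu d) = (\<Sum>d | d dvd m \<and> squarefree d. moebius_mu d)"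
    using assms by (intro sum.mono_neutral_right) (auto simp: moebius_mu_def)
  also have "\<dots> = (\<Sum>S\<in>Pow (prime_factors m). (- 1) ^ card S)"
  proof (rule sum.reindex_bij_witness[where i = Prod and j = prime_factors])
    fix S assume S: "S \<in> Pow (prime_factors m)"
    have fin: "finite S" using S by (auto intro: finite_subset)
    have primes: "prime p" if "p \<in> S" for p using S that by auto
    show "prime_factors (\<Prod>S) = S"
      using fin primes by (rule prime_factors_prod_primes)
    have "\<Prod>S dvd m"
    proof -
      have "\<Prod>S dvd \<Prod>(prime_factors m)"
        using S by (intro prod_dvd_prod_subset) auto
      also have "\<dots> dvd (\<Prod>p\<in>prime_factors m. p ^ multiplicity p m)"
        by (intro prod_dvd_prod dvd_power) (auto simp: prime_factors_multiplicity)
      also have "\<dots> = m"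
        using assms by (simp add: prod_prime_factors)
      finally show ?thesis .
    qed
    then show "\<Prod>S \<in> {d. d dvd m \<and> squarefree d}"
      using primes by (simp add: squarefree_prod_primes)
  qed (use assms in \<open>auto simp: prod_prime_factors_squarefree moebius_mu_def
        dest: dvd_prime_factors[rotated]\<close>)
  also have "\<dots> = (if m = 1 then 1 else 0)"
    using assms by (subst sum_minus_one_power_card_Pow) (auto simp: prime_factorization_empty_iff)
  finally show ?thesis .
qed

text \<open>Grouping the double sum by m = j * k, the coefficient of \<open>g m\<close> is the sum
  of the Moebius function over the divisors of m, so only m = 1 survives. The vanishing of
  \<open>g\<close> beyond \<open>N\<close> allows the truncation of both sums.\<close>

lemma moebius_inversion_multiples:
  fixes g :: "nat \<Rightarrow> 'a :: comm_ring_1"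
  assumes g: "\<And>m. m > N \<Longrightarrow> g m = 0"
  shows "(\<Sum>j=1..N. of_int (moebius_mu j) * (\<Sum>k=1..N. g (j * k))) = g 1"
proof -
  \<comment> \<open>Terms with j * k > N vanish, and j * k <= N forces k <= N as j >= 1; hence m = j
    * k runs through exactly the multiples of j up to N.\<close>
  have multiples: "(\<Sum>k=1..N. g (j * k)) = (\<Sum>m | m \<in> {1..N} \<and> j dvd m. g m)" if "j \<in> {1..N}" for j
  proof -
    have bound: "k \<le> N" if "j * k \<le> N" for k
      by (rule order.trans[OF _ that]) (use \<open>j \<in> {1..N}\<close> in simp)
    have "(\<Sum>k=1..N. g (j * k)) = (\<Sum>k | k \<in> {1..N} \<and> j * k \<le> N. g (j * k))"
      by (intro sum.mono_neutral_right ballI) (auto simp: g not_le)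
    also have "\<dots> = (\<Sum>m | m \<in> {1..N} \<and> j dvd m. g m)"
      using that
      by (intro sum.reindex_bij_witness[where i = "\<lambda>m. m div j" and j = "\<lambda>k. j * k"])
         (auto elim!: dvdE intro: bound)
    finally show ?thesis .
  qed
  have "(\<Sum>j=1..N. of_int (moebius_mu j) * (\<Sum>k=1..N. g (j * k)))
      = (\<Sum>j=1..N. \<Sum>m | m \<in> {1..N} \<and> j dvd m. of_int (moebius_mu j) * g m)"
    by (intro sum.cong refl) (simp only: multiples sum_distrib_left)
  also have "\<dots> = (\<Sum>m=1..N. \<Sum>j | j \<in> {1..N} \<and> j dvd m. of_int (moebius_mu j) * g m)"
    by (rule sum.swap_restrict) auto
  also have "\<dots> = (\<Sum>m=1..N. if m = 1 then g m else 0)"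
  proof (intro sum.cong refl)
    fix m assume m: "m \<in> {1..N}"
    then have "{j. j \<in> {1..N} \<and> j dvd m} = {j. j dvd m}"
      by (auto dest: dvd_imp_le intro: Suc_leI dvd_pos_nat)
    then have "(\<Sum>j | j \<in> {1..N} \<and> j dvd m. of_int (moebius_mu j) * g m)
        = of_int (\<Sum>j | j dvd m. moebius_mu j) * g m"
      by (simp add: sum_distrib_right)
    also have "\<dots> = (if m = 1 then g m else 0)"
      using m by (subst sum_moebius_mu_divisors) auto
    finally show "(\<Sum>j | j \<in> {1..N} \<and> j dvd m. of_int (moebius_mu j) * g m)
        = (if m = 1 then g m else 0)" .
  qed
  also have "\<dots> = g 1"
    \<comment> \<open>For N = 0 the sum is empty, and \<open>g 1\<close> is 0 by the vanishing
      hypothesis.\<close>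
    using g by (cases "N = 0") (simp_all add: sum.delta)
  finally show ?thesis .
qed

section \<open>Coefficients of \<open>B\<close> and \<open>Bhat\<close> as finite sums, and the
  geometric expansion\<close>

lemma b_eq_sum:
  "b a N = (\<Sum>n=1..N. fps_nth (fps_X ^ (n\<^sup>2 + a * n) / (qfact n)\<^sup>2) N)"
  unfolding b_def
proof (rule has_sum_fps_nth)
  show "((\<lambda>n. fps_X ^ (n\<^sup>2 + a * n) / (qfact n)\<^sup>2) has_sum B a) {1..}"
    unfolding B_def using summable_B by (rule has_sum_infsum)
\<comment> \<open>For n > N the exponent n^2 + a * n exceeds N, and the denominator has constant
  term 1.\<close>
qed (auto intro!: fps_X_power_divide_nth_low less_square_add simp: fps_nth_power_0 qfact_nth_0)

lemma bhat_eq_sum: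
  assumes "a > 0"
  shows "bhat a N = (\<Sum>n=1..N. fps_nth (fps_X ^ (n\<^sup>2 + a * n) /
           ((qfact n)\<^sup>2 * (1 - fps_X ^ (a * n)))) N)"
  unfolding bhat_def
proof (rule has_sum_fps_nth)
  show "((\<lambda>n. fps_X ^ (n\<^sup>2 + a * n) / ((qfact n)\<^sup>2 * (1 - fps_X ^ (a * n)))) has_sum Bhat a) {1..}"
    unfolding Bhat_def using summable_Bhat[OF assms] by (rule has_sum_infsum)
qed (use assms in \<open>auto intro!: fps_X_power_divide_nth_low less_square_add
       simp: fps_nth_power_0 qfact_nth_0 power_0_left\<close>)

lemma b_eq_0:
  assumes "N < a"
  shows "b a N = 0"
  unfolding b_eq_sum
proof (intro sum.neutral ballI fps_X_power_divide_nth_low)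
  fix n assume "n \<in> {1..N}"
  then have "a \<le> a * n" by simp
  with assms show "N < n\<^sup>2 + a * n" by linarith
qed (simp add: fps_nth_power_0 qfact_nth_0)

text \<open>The geometric series is cut off after \<open>J\<close> terms. The remainder has a factor
  \<open>fps_X ^ (m * (J + 1))\<close>, whose exponent exceeds \<open>N\<close>, so coefficient
  \<open>N\<close> does not see it.\<close>

lemma fps_X_power_divide_geometric_nth:
  fixes c :: "'a :: field fps"
  assumes c: "fps_nth c 0 \<noteq> 0" and "m > 0" "N < m * (J + 1)"
  shows "fps_nth (fps_X ^ (s + m) / (c * (1 - fps_X ^ m))) N
       = (\<Sum>j=1..J. fps_nth (fps_X ^ (s + m * j) / c) N)"
proof -
  define x :: "'a fps" where "x = fps_X ^ m"
  have x: "fps_nth x 0 = 0"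
    using \<open>m > 0\<close> by (simp add: x_def)
  have unit: "(1 - x) * inverse (1 - x) = 1"
    by (rule inverse_mult_eq_1') (simp add: x)
  \<comment> \<open>The finite geometric sum telescopes against 1 - x; the remainder is kept
    explicit.\<close>
  have geom: "(\<Sum>j=1..J. x ^ j) = x * inverse (1 - x) - x ^ (J + 1) * inverse (1 - x)"
  proof -
    have "(\<Sum>j=1..J. x ^ j) * (1 - x) = x - x ^ (J + 1)"
    proof (induction J)
      case (Suc J)
      have "(\<Sum>j=1..Suc J. x ^ j) * (1 - x) = (\<Sum>j=1..J. x ^ j) * (1 - x) + x ^ Suc J * (1 - x)"
        by (simp add: distrib_right)
      also have "\<dots> = x - x ^ (Suc J + 1)"
        unfolding Suc.IH by (simp add: algebra_simps)
      finally show ?case .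
    qed simp
    then have "(\<Sum>j=1..J. x ^ j) * ((1 - x) * inverse (1 - x)) = (x - x ^ (J + 1)) * inverse (1 - x)"
      by (simp only: mult.assoc[symmetric])
    then show ?thesis
      unfolding unit by (simp add: left_diff_distrib)
  qed
  have "fps_X ^ (s + m) / (c * (1 - x)) = fps_X ^ s * x * inverse (1 - x) * inverse c"
    using c x by (simp add: fps_divide_unit fps_inverse_mult power_add x_def mult_ac)
  also have "\<dots> = (\<Sum>j=1..J. fps_X ^ s * x ^ j * inverse c)
      + fps_X ^ s * x ^ (J + 1) * inverse (1 - x) * inverse c"
    unfolding sum_distrib_left[symmetric] sum_distrib_right[symmetric] geom
    by (simp add: algebra_simps)
  also have "(\<Sum>j=1..J. fps_X ^ s * x ^ j * inverse c) = (\<Sum>j=1..J. fps_X ^ (s + m * j) / c)"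
    using c by (simp add: fps_divide_unit power_add power_mult x_def)
  also have "fps_X ^ s * x ^ (J + 1) * inverse (1 - x) * inverse c
      = fps_X ^ (s + m * (J + 1)) * (inverse (1 - x) * inverse c)"
    by (simp only: x_def power_add power_mult mult_ac)
  finally show ?thesis
    using \<open>N < m * (J + 1)\<close> by (simp add: x_def fps_sum_nth fps_X_power_mult_nth)
qed

section \<open>Passing between \<open>b\<close> and \<open>bhat\<close>\<close>

lemma bhat_eq_sum_b:
  assumes "a > 0"
  shows "bhat a N = (\<Sum>j=1..N. b (a * j) N)"
proof -
  have "fps_nth (fps_X ^ (n\<^sup>2 + a * n) / ((qfact n)\<^sup>2 * (1 - fps_X ^ (a * n)))) N
      = (\<Sum>j=1..N. fps_nth (fps_X ^ (n\<^sup>2 + a * j * n) / (qfact n)\<^sup>2) N)" if "n \<in> {1..N}" for n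
  proof -
    \<comment> \<open>Since a * n >= 1, the cutoff J = N works for every n at once; this common
      range is what permits swapping the sums over n and j.\<close>
    have "1 * (N + 1) \<le> a * n * (N + 1)"
      using assms that by (intro mult_le_mono1) auto
    then have "N < a * n * (N + 1)" by simp
    then show ?thesis
      using assms that
      by (subst fps_X_power_divide_geometric_nth[where J = N])
         (auto simp: fps_nth_power_0 qfact_nth_0 mult_ac)
  qed
  then have "bhat a N = (\<Sum>n=1..N. \<Sum>j=1..N.
      fps_nth (fps_X ^ (n\<^sup>2 + a * j * n) / (qfact n)\<^sup>2) N)"
    unfolding bhat_eq_sum[OF assms] by (intro sum.cong refl)
  also have "\<dots> = (\<Sum>j=1..N. b (a * j) N)"
    unfolding b_eq_sum by (rule sum.swap)
  finally show ?thesis .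
qed

lemma b_mult_eq_0:
  assumes "a > 0" "N < j"
  shows "b (a * j) N = 0"
proof (rule b_eq_0)
  have "j \<le> a * j" using assms by simp
  with assms show "N < a * j" by linarith
qed

lemma bhat_mult_eq_0:
  assumes "a > 0" "N < j"
  shows "bhat (a * j) N = 0"
proof -
  have "bhat (a * j) N = (\<Sum>i=1..N. b (a * j * i) N)"
    using assms by (intro bhat_eq_sum_b) simp
  \<comment> \<open>Regrouped so that the large factor j is the multiplier and a * i takes the role
    of \<open>a\<close> in \<open>b_mult_eq_0\<close>.\<close>
  also have "\<dots> = (\<Sum>i=1..N. b (a * i * j) N)"
    by (simp add: mult_ac)
  also have "\<dots> = 0"
    using assms by (intro sum.neutral ballI b_mult_eq_0) auto
  finally show ?thesis .
qed

lemma b_eq_sum_moebius_bhat: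
  assumes "a > 0"
  shows "b a N = (\<Sum>j=1..N. of_int (moebius_mu j) * bhat (a * j) N)"
proof -
  have "(\<Sum>j=1..N. of_int (moebius_mu j) * bhat (a * j) N)
      = (\<Sum>j=1..N. of_int (moebius_mu j) * (\<Sum>k=1..N. b (a * (j * k)) N))"
    using assms by (intro sum.cong refl) (simp add: bhat_eq_sum_b mult_ac)
  \<comment> \<open>Inversion is applied to g m = b (a * m) N, which vanishes for m > N.\<close>
  also have "\<dots> = b (a * 1) N"
    using assms by (intro moebius_inversion_multiples b_mult_eq_0)
  finally show ?thesis by simp
qed

theorem theorem2p3:
  fixes a :: nat
  assumes "a > 0"
  shows "(\<forall>n. ((\<lambda>j. b (a * j) n) has_sum bhat a n) {1..}) \<and>
         ((\<lambda>n. of_int (moebius_mu n) * Bhat (a * n)) has_sum B a) {1..} \<and>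
         (\<forall>n. ((\<lambda>j. of_int (moebius_mu j) * bhat (a * j) n) has_sum b a n) {1..})"
proof (intro conjI allI)
  fix n
  show "((\<lambda>j. b (a * j) n) has_sum bhat a n) {1..}"
    using assms
    by (intro has_sum_finite_neutralI[where B = "{1..n}"]) (auto simp: b_mult_eq_0 bhat_eq_sum_b)
  show "((\<lambda>j. of_int (moebius_mu j) * bhat (a * j) n) has_sum b a n) {1..}"
    using assms
    by (intro has_sum_finite_neutralI[where B = "{1..n}"])
       (auto simp: bhat_mult_eq_0 b_eq_sum_moebius_bhat)
next
  \<comment> \<open>The Moebius factor is a constant power series, so it merely scales each
    coefficient.\<close>
  have nth: "fps_nth (of_int (moebius_mu j) * Bhat (a * j)) N
      = of_int (moebius_mu j) * bhat (a * j) N" for j N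
    by (simp add: bhat_def fps_of_int[symmetric])
  have zero: "N < j \<Longrightarrow> fps_nth (of_int (moebius_mu j) * Bhat (a * j)) N = 0" for j N
    using assms by (subst nth) (simp add: bhat_mult_eq_0)
  show "((\<lambda>n. of_int (moebius_mu n) * Bhat (a * n)) has_sum B a) {1..}"
  \<comment> \<open>Convergence is checked per coefficient: the support lies in
    \<open>{1..N}\<close>, and the sum over it is the inversion formula for
    \<open>b a N\<close>.\<close>
  proof (rule has_sum_fpsI)
    fix N
    have supp: "{j \<in> {1..}. fps_nth (of_int (moebius_mu j) * Bhat (a * j)) N \<noteq> 0} \<subseteq> {1..N}"
    proof
      fix j assume "j \<in> {j \<in> {1..}. fps_nth (of_int (moebius_mu j) * Bhat (a * j)) N \<noteq> 0}"
      then have j: "1 \<le> j" "fps_nth (of_int (moebius_mu j) * Bhat (a * j)) N \<noteq> 0"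
        unfolding mem_Collect_eq atLeast_iff by blast+
      from j(2) have "\<not> N < j" by (rule contrapos_nn) (rule zero)
      with j(1) show "j \<in> {1..N}" by simp
    qed
    then show "finite {j \<in> {1..}. fps_nth (of_int (moebius_mu j) * Bhat (a * j)) N \<noteq> 0}"
      by (rule finite_subset) simp
    have "fps_nth (B a) N = (\<Sum>j=1..N. fps_nth (of_int (moebius_mu j) * Bhat (a * j)) N)"
      unfolding nth using b_eq_sum_moebius_bhat[OF assms] by (simp add: b_def)
    also have "\<dots> = (\<Sum>j | j \<in> {1..} \<and> fps_nth (of_int (moebius_mu j) * Bhat (a * j)) N \<noteq> 0.
        fps_nth (of_int (moebius_mu j) * Bhat (a * j)) N)"
      using supp by (intro sum.mono_neutral_right) auto
    finally show "fps_nth (B a) N = \<dots>" .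
  qed
qed

end
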